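(* Let $G=(V,q)$ be a reversible connected graph with non-negative Ollivier curvature, let $\widetilde G=(V\times V,\widetilde q)$ be a perfect coupling graph of $G$ with heat semigroup $\widetilde P_t$, and let $W:=V^2\setminus\{(x,x):x\in V\}$. Then for all $t>0$ and $x,y\in V$, \[ \widetilde P_t1_W(x,y)\le\phi_t(d(x,y))\le\frac{d(x,y)}{2\sqrt{t\,q_{\min}}}. \]
   Context: A graph $G=(V,q)$ consists of a countable set $V$ and a function $q:V\times V\to[0,\infty)$ such that $\#\{y:q(x,y)>0\}<\infty$ for every $x\in V$; its Laplacian is $\Delta f(x)=\sum_y q(x,y)(f(y)-f(x))$. $G$ is reversible if there is $m:V\to(0,\infty)$ with $q(x,y)m(x)=q(y,x)m(y)$. For reversible $G$, $d$ is the combinatorial graph distance (finite since $G$ is connected). $q_{\min}:=\inf\{q(x,y):q(x,y)>0\}$. Ollivier curvature: for $x\ne y$ let $\nabla_{xy}f=(f(x)-f(y))/d(x,y)$, $\|\nabla f\|_\infty=\sup_{x\ne y}|\nabla_{xy}f|$, $\kappa(x,y)=\inf\{\nabla_{xy}\Delta f:\|\nabla f\|_\infty=1,\ \nabla_{yx}f=1\}$; non-negative curvature means $\kappa\ge0$ for all $x\ne y$. Heat semigroup of any graph: for finite $S$ let $q_S(x,y)=q(x,y)1_S(x)$ with Laplacian $\Delta_S$ and $P^S_tf=\sum_{k\ge0}t^k\Delta_S^k(f1_S)/k!$; for bounded $f$, $P_tf=\lim_iP_t^{S_i}f$ pointwise along any increasing finite exhaustion. $(f\otimes g)(x,y)=f(x)g(y)$.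 A coupling graph of $G$ is a graph $\widetilde G=(V\times V,\widetilde q)$ whose Laplacian satisfies $\widetilde\Delta(f\otimes 1)=\Delta f\otimes 1$ and $\widetilde\Delta(1\otimes f)=1\otimes\Delta f$ for all $f$. A transport plan from $x_0$ to $y_0$ is $\rho:V\times V\to[0,\infty)$ with $\sum_{y}\rho(x,y)=q(x_0,x)$ for $x\neq x_0$ and $\sum_x\rho(x,y)=q(y_0,y)$ for $y\ne y_0$; $\mathrm{cost}(\rho)=\sum_{x,y}\rho(x,y)(d(x_0,y_0)-d(x,y))$; $\mu_\rho(k)=\sum_{d(x,y)-d(x_0,y_0)=k}\rho(x,y)$; optimal = cost-maximizing. A coupling graph is perfect if each $\rho_{x_0y_0}:=\widetilde q((x_0,y_0),(\cdot,\cdot))$ is optimal, has $\mu_{\rho_{x_0y_0}}(k)=0$ for $|k|>1$, and has $\mu_{\rho_{x_0y_0}}(-1)\ge 2q_{\min}$ when $x_0\ne y_0$. $\phi_t(n):=P^{\mathbb N_0}_t1_{\mathbb N_+}(n)$, with $P^{\mathbb N_0}_t$ the heat semigroup of the graph on $\mathbb N_0$ with rates $q_0(x,y)=2q_{\min}$ if $|x-y|=1$ and $x>0$, and $0$ otherwise. *)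

theory Defs
  imports "HOL-Analysis.Analysis" "HOL-Library.Extended_Real"
begin

section \<open>Graphs, Laplacian\<close>

text \<open>A graph on the vertex type 'v (V = UNIV) is a rate function q with
  non-negative values and finitely many out-neighbours at every vertex.\<close>
definition is_graph :: "('v \<Rightarrow> 'v \<Rightarrow> real) \<Rightarrow> bool" where
  "is_graph q \<longleftrightarrow> (\<forall>x y. q x y \<ge> 0) \<and> (\<forall>x. finite {y. q x y > 0})"

definition lap :: "('v \<Rightarrow> 'v \<Rightarrow> real) \<Rightarrow> ('v \<Rightarrow> real) \<Rightarrow> 'v \<Rightarrow> real" where
  "lap q f x = (\<Sum>y\<in>{y. q x y > 0}. q x y * (f y - f x))"

definition reversible :: "('v \<Rightarrow> 'v \<Rightarrow> real) \<Rightarrow> bool" where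
  "reversible q \<longleftrightarrow> (\<exists>m :: 'v \<Rightarrow> real. (\<forall>x. m x > 0) \<and> (\<forall>x y. q x y * m x = q y x * m y))"

definition adj :: "('v \<Rightarrow> 'v \<Rightarrow> real) \<Rightarrow> ('v \<times> 'v) set" where
  "adj q = {(x, y). q x y > 0}"

definition graph_connected :: "('v \<Rightarrow> 'v \<Rightarrow> real) \<Rightarrow> bool" where
  "graph_connected q \<longleftrightarrow> (\<forall>x y. (x, y) \<in> (adj q)\<^sup>*)"

text \<open>Combinatorial graph distance.\<close>
definition gdist :: "('v \<Rightarrow> 'v \<Rightarrow> real) \<Rightarrow> 'v \<Rightarrow> 'v \<Rightarrow> nat" where
  "gdist q x y = (LEAST n. (x, y) \<in> (adj q) ^^ n)"

definition qmin :: "('v \<Rightarrow> 'v \<Rightarrow> real) \<Rightarrow> real" where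
  "qmin q = Inf {q x y | x y. q x y > 0}"

section \<open>Ollivier curvature\<close>

definition grad :: "('v \<Rightarrow> 'v \<Rightarrow> real) \<Rightarrow> 'v \<Rightarrow> 'v \<Rightarrow> ('v \<Rightarrow> real) \<Rightarrow> real" where
  "grad q x y f = (f x - f y) / real (gdist q x y)"

definition grad_sup :: "('v \<Rightarrow> 'v \<Rightarrow> real) \<Rightarrow> ('v \<Rightarrow> real) \<Rightarrow> ereal" where
  "grad_sup q f = (SUP p\<in>{(x, y). x \<noteq> y}. ereal \<bar>grad q (fst p) (snd p) f\<bar>)"

definition ollivier :: "('v \<Rightarrow> 'v \<Rightarrow> real) \<Rightarrow> 'v \<Rightarrow> 'v \<Rightarrow> ereal" where
  "ollivier q x y = (INF f\<in>{f. grad_sup q f = 1 \<and> grad q y x f = 1}. ereal (grad q x y (lap q f)))"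

definition nonneg_curvature :: "('v \<Rightarrow> 'v \<Rightarrow> real) \<Rightarrow> bool" where
  "nonneg_curvature q \<longleftrightarrow> (\<forall>x y. x \<noteq> y \<longrightarrow> ollivier q x y \<ge> 0)"

section \<open>Heat semigroup\<close>

definition restr :: "('v \<Rightarrow> 'v \<Rightarrow> real) \<Rightarrow> 'v set \<Rightarrow> 'v \<Rightarrow> 'v \<Rightarrow> real" where
  "restr q S x y = q x y * indicator S x"

definition heatS :: "('v \<Rightarrow> 'v \<Rightarrow> real) \<Rightarrow> 'v set \<Rightarrow> real \<Rightarrow> ('v \<Rightarrow> real) \<Rightarrow> 'v \<Rightarrow> real" where
  "heatS q S t f x = (\<Sum>k. t ^ k / fact k * (((lap (restr q S)) ^^ k) (\<lambda>z. f z * indicator S z)) x)"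

text \<open>Heat semigroup: pointwise limit of the Dirichlet semigroups along the
  finite subsets directed by inclusion (equivalent to the limit along every
  increasing finite exhaustion).\<close>
definition heat :: "('v \<Rightarrow> 'v \<Rightarrow> real) \<Rightarrow> real \<Rightarrow> ('v \<Rightarrow> real) \<Rightarrow> 'v \<Rightarrow> real" where
  "heat q t f x = Lim (finite_subsets_at_top UNIV) (\<lambda>S. heatS q S t f x)"

section \<open>Coupling graphs and transport plans\<close>

definition coupling_graph ::
  "('v \<Rightarrow> 'v \<Rightarrow> real) \<Rightarrow> ('v \<times> 'v \<Rightarrow> 'v \<times> 'v \<Rightarrow> real) \<Rightarrow> bool" where
  "coupling_graph q qt \<longleftrightarrow> is_graph qt \<and>
     (\<forall>f. lap qt (\<lambda>(x, y). f x) = (\<lambda>(x, y). lap q f x)) \<and>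
     (\<forall>f. lap qt (\<lambda>(x, y). f y) = (\<lambda>(x, y). lap q f y))"

definition transport_plan ::
  "('v \<Rightarrow> 'v \<Rightarrow> real) \<Rightarrow> 'v \<Rightarrow> 'v \<Rightarrow> ('v \<times> 'v \<Rightarrow> real) \<Rightarrow> bool" where
  "transport_plan q x0 y0 \<rho> \<longleftrightarrow> (\<forall>p. \<rho> p \<ge> 0) \<and>
     (\<forall>x. x \<noteq> x0 \<longrightarrow> ((\<lambda>y. \<rho> (x, y)) has_sum q x0 x) UNIV) \<and>
     (\<forall>y. y \<noteq> y0 \<longrightarrow> ((\<lambda>x. \<rho> (x, y)) has_sum q y0 y) UNIV)"

definition tcost :: "('v \<Rightarrow> 'v \<Rightarrow> real) \<Rightarrow> 'v \<Rightarrow> 'v \<Rightarrow> ('v \<times> 'v \<Rightarrow> real) \<Rightarrow> real" where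
  "tcost q x0 y0 \<rho> = (\<Sum>\<^sub>\<infinity>p\<in>UNIV. \<rho> p * (real (gdist q x0 y0) - real (gdist q (fst p) (snd p))))"

definition tmu :: "('v \<Rightarrow> 'v \<Rightarrow> real) \<Rightarrow> 'v \<Rightarrow> 'v \<Rightarrow> ('v \<times> 'v \<Rightarrow> real) \<Rightarrow> int \<Rightarrow> real" where
  "tmu q x0 y0 \<rho> k = (\<Sum>\<^sub>\<infinity>p\<in>{p. int (gdist q (fst p) (snd p)) - int (gdist q x0 y0) = k}. \<rho> p)"

definition optimal_plan ::
  "('v \<Rightarrow> 'v \<Rightarrow> real) \<Rightarrow> 'v \<Rightarrow> 'v \<Rightarrow> ('v \<times> 'v \<Rightarrow> real) \<Rightarrow> bool" where
  "optimal_plan q x0 y0 \<rho> \<longleftrightarrow> transport_plan q x0 y0 \<rho> \<and>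
     (\<forall>\<rho>'. transport_plan q x0 y0 \<rho>' \<longrightarrow> tcost q x0 y0 \<rho>' \<le> tcost q x0 y0 \<rho>)"

definition perfect_coupling ::
  "('v \<Rightarrow> 'v \<Rightarrow> real) \<Rightarrow> ('v \<times> 'v \<Rightarrow> 'v \<times> 'v \<Rightarrow> real) \<Rightarrow> bool" where
  "perfect_coupling q qt \<longleftrightarrow> coupling_graph q qt \<and>
     (\<forall>x0 y0. optimal_plan q x0 y0 (qt (x0, y0)) \<and>
        (\<forall>k. \<bar>k\<bar> > 1 \<longrightarrow> tmu q x0 y0 (qt (x0, y0)) k = 0) \<and>
        (x0 \<noteq> y0 \<longrightarrow> tmu q x0 y0 (qt (x0, y0)) (-1) \<ge> 2 * qmin q))"

section \<open>The comparison function phi\<close>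

definition q0 :: "real \<Rightarrow> nat \<Rightarrow> nat \<Rightarrow> real" where
  "q0 c x y = (if (y = x + 1 \<or> x = y + 1) \<and> x > 0 then 2 * c else 0)"

definition phi :: "real \<Rightarrow> real \<Rightarrow> nat \<Rightarrow> real" where
  "phi c t n = heat (q0 c) t (indicator {0<..}) n"

end

theory Submission
  imports Defs
begin

text \<open>The function \<open>\<phi>\<^sub>t \<circ> d\<close> is a supersolution of the heat equation of the coupling graph with
  initial value \<open>1\<^sub>W\<close>: non-negative curvature and Kantorovich duality show that the optimal plan
  decreases the distance at least as fast as it increases it, the decreasing rate is at least
  \<open>2 q\<^sub>m\<^sub>i\<^sub>n\<close>, and \<open>\<phi>\<^sub>t\<close> is increasing and concave. The maximum principle on finite sets then gives
  the first inequality. For the second one, \<open>\<phi>\<^sub>t(n)\<close> is the probability that a symmetric walk from \<open>n\<close>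
  has not hit \<open>0\<close>; by concavity it is at most \<open>n \<phi>\<^sub>t(1)\<close>, and the discrete probability from \<open>1\<close> after
  \<open>m\<close> steps is \<open>binomial(m, m/2) / 2\<^sup>m \<le> 1 / sqrt (m + 1)\<close>, which is averaged over the
  Poisson number of steps.\<close>

section \<open>Heat semigroup and maximum principle\<close>

lemma lap_restr: "lap (restr q S) f x = indicator S x * lap q f x"
  by (auto simp: lap_def restr_def indicator_def)

lemma lap_diff: "lap q (\<lambda>y. f y - g y) x = lap q f x - lap q g x"
  by (simp add: lap_def algebra_simps flip: sum_subtractf)

text \<open>Adding \<open>e * (1 + t)\<close> makes the differential inequality strict and the
  values initially and off \<open>S\<close> positive. At the first time the perturbed function
  reaches 0 on \<open>S\<close> it has a spatial minimum there, so its Laplacian is nonnegative and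
  its time derivative positive; hence it was already negative shortly before.\<close>

lemma minimum_principle:
  fixes v v' :: "real \<Rightarrow> 'v \<Rightarrow> real"
  assumes q: "\<And>x y. 0 \<le> q x y" and S: "finite S"
    and deriv: "\<And>s x. 0 \<le> s \<Longrightarrow> x \<in> S \<Longrightarrow> ((\<lambda>s. v s x) has_real_derivative v' s x) (at s)"
    and super: "\<And>s x. 0 \<le> s \<Longrightarrow> x \<in> S \<Longrightarrow> lap q (v s) x \<le> v' s x"
    and outside: "\<And>s x. 0 \<le> s \<Longrightarrow> x \<notin> S \<Longrightarrow> 0 \<le> v s x"
    and init: "\<And>x. x \<in> S \<Longrightarrow> 0 \<le> v 0 x"
    and t: "0 \<le> t"
  shows "0 \<le> v t x"
proof -
  have pos: "0 < v t x + e * (1 + t)" if e: "0 < e" for e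
  proof (rule ccontr)
    define z where "z s x = v s x + e * (1 + s)" for s x
    have z_out: "0 < z s x" if "0 \<le> s" "x \<notin> S" for s x
      using outside[OF that] e that by (simp add: z_def add_nonneg_pos)
    have z_init: "0 < z 0 x" for x
      using init[of x] z_out[of 0 x] e by (cases "x \<in> S") (auto simp: z_def)
    assume "\<not> 0 < v t x + e * (1 + t)"
    then have bad: "z t x \<le> 0" by (simp add: z_def)
    have z_deriv: "((\<lambda>s. z s x) has_real_derivative v' s x + e) (at s)"
      if "0 \<le> s" "x \<in> S" for s x
      unfolding z_def by (rule derivative_eq_intros deriv[OF that] refl)+ simp
    have z_cont: "isCont (\<lambda>s. z s x) s" if "0 \<le> s" "x \<in> S" for s x
      using z_deriv[OF that] by (rule DERIV_isCont)
    \<comment> \<open>The bad times. Finiteness of \<open>S\<close> makes this set closed, so a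
      first bad time exists.\<close>
    define B where "B = (\<Union>x\<in>S. {s\<in>{0..t}. z s x \<le> 0})"
    have "closed {s\<in>{0..t}. z s x \<le> 0}" if "x \<in> S" for x
      by (intro continuous_on_closed_Collect_le continuous_at_imp_continuous_on ballI continuous_intros)
        (use z_cont that in auto)
    then have "closed B" unfolding B_def by (intro closed_UN S) auto
    moreover have "bounded B"
      by (rule bounded_subset[of "{0..t}"]) (auto simp: B_def)
    ultimately have "compact B" by (simp add: compact_eq_bounded_closed)
    moreover have "t \<in> B" using bad z_out[of t x] t by (force simp: B_def)
    ultimately obtain s where s: "s \<in> B" and s_min: "\<And>r. r \<in> B \<Longrightarrow> s \<le> r"
      using compact_attains_inf[of B] by blast
    from s obtain a where a: "a \<in> S" "z s a \<le> 0" and s_t: "0 \<le> s" "s \<le> t"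
      by (auto simp: B_def)
    have "s \<noteq> 0" using a z_init[of a] by auto
    with s_t have s0: "0 < s" by simp
    have before: "0 < z r y" if "0 \<le> r" "r < s" for r y
      using s_min[of r] z_out[of r y] that s_t
      by (cases "y \<in> S") (force simp: B_def not_less)+
    have nonneg: "0 \<le> z s y" for y
    proof (cases "y \<in> S")
      case True
      have "((\<lambda>r. z r y) \<longlongrightarrow> z s y) (at_left s)"
        using z_cont[OF s_t(1) True] by (simp add: isCont_def filterlim_at_split)
      moreover have "\<forall>\<^sub>F r in at_left s. 0 \<le> z r y"
        using eventually_at_left_real[OF s0] by eventually_elim (auto intro!: less_imp_le before)
      ultimately show ?thesis by (rule tendsto_lowerbound) simp
    qed (use z_out s_t in \<open>force intro: less_imp_le\<close>)
    have "0 \<le> lap q (z s) a"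
      unfolding lap_def using nonneg a q by (intro sum_nonneg mult_nonneg_nonneg) (auto intro: order_trans)
    also have "lap q (z s) a = lap q (v s) a" by (simp add: lap_def z_def)
    also have "\<dots> < v' s a + e" using super[OF s_t(1) a(1)] e by simp
    finally have "0 < v' s a + e" .
    from DERIV_pos_inc_left[OF z_deriv[OF s_t(1) a(1)] this]
    obtain d where d: "0 < d" "\<And>h. 0 < h \<Longrightarrow> h < d \<Longrightarrow> z (s - h) a < z s a" by blast
    define h where "h = min (d / 2) (s / 2)"
    have "z (s - h) a < z s a" "0 < z (s - h) a"
      using d s0 by (auto simp: h_def min_def intro!: d before)
    with a show False by simp
  qed
  show ?thesis
  proof (rule field_le_epsilon)
    fix e :: real assume "0 < e"
    then have "0 < e / (1 + t)" using t by simp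
    from pos[OF this] show "0 \<le> v t x + e" using t by simp
  qed
qed

section \<open>Dirichlet semigroups on finite sets\<close>

lemma heatS_0: "x \<in> S \<Longrightarrow> heatS q S 0 f x = f x"
  unfolding heatS_def by (subst suminf_finite[of "{0}"]) auto

lemma funpow_lap_restr_outside:
  "x \<notin> S \<Longrightarrow> (lap (restr q S) ^^ k) (\<lambda>z. f z * indicator S z) x = 0"
  by (cases k) (auto simp: lap_restr)

lemma heatS_outside: "x \<notin> S \<Longrightarrow> heatS q S t f x = 0"
  by (simp add: heatS_def funpow_lap_restr_outside)

text \<open>\<open>M\<close> bounds the sup-norm operator norm of the restricted Laplacian: it adds
  up over \<open>S\<close> twice the exit rates. This is crude but makes the exponential series
  converge.\<close>

lemma funpow_lap_restr_bound:
  fixes q :: "'v \<Rightarrow> 'v \<Rightarrow> real"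
  assumes q: "is_graph q" and S: "finite S" and g: "\<And>x. \<bar>g x\<bar> \<le> C"
  defines "M \<equiv> \<Sum>x\<in>S. \<Sum>y\<in>{y. q x y > 0}. 2 * q x y"
  shows "\<bar>(lap (restr q S) ^^ k) g x\<bar> \<le> M ^ k * C"
proof (induction k arbitrary: x)
  case (Suc k)
  let ?g = "(lap (restr q S) ^^ k) g"
  let ?B = "M ^ k * C"
  have nn: "0 \<le> q x y" for x y using q by (simp add: is_graph_def)
  have M: "0 \<le> M" unfolding M_def by (intro sum_nonneg mult_nonneg_nonneg) (auto simp: nn)
  have B: "0 \<le> ?B" using g[of x] M by (simp add: order_trans[OF abs_ge_zero])
  show ?case
  proof (cases "x \<in> S")
    case True
    have "\<bar>lap q ?g x\<bar> \<le> (\<Sum>y\<in>{y. q x y > 0}. \<bar>q x y * (?g y - ?g x)\<bar>)"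
      unfolding lap_def by (rule sum_abs)
    also have "\<dots> \<le> (\<Sum>y\<in>{y. q x y > 0}. 2 * q x y * ?B)"
    proof (rule sum_mono)
      fix y
      have "\<bar>?g y - ?g x\<bar> \<le> 2 * ?B" using Suc.IH[of x] Suc.IH[of y] by linarith
      then have "q x y * \<bar>?g y - ?g x\<bar> \<le> q x y * (2 * ?B)" by (rule mult_left_mono) (rule nn)
      then show "\<bar>q x y * (?g y - ?g x)\<bar> \<le> 2 * q x y * ?B" using nn[of x y] by (simp add: abs_mult)
    qed
    also have "\<dots> = (\<Sum>y\<in>{y. q x y > 0}. 2 * q x y) * ?B" by (simp add: sum_distrib_right)
    also have "\<dots> \<le> M * ?B"
      unfolding M_def using B True
      by (intro mult_right_mono member_le_sum S) (auto intro!: sum_nonneg simp: nn M_def)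
    finally show ?thesis using True by (simp add: lap_restr[of q S ?g x])
  qed (use M B in \<open>simp add: lap_restr[of q S ?g x] mult.assoc\<close>)
qed (use g in simp)

lemma heatS_deriv:
  assumes q: "is_graph q" and S: "finite S" and x: "x \<in> S"
  shows "((\<lambda>t. heatS q S t f x) has_real_derivative lap q (heatS q S t f) x) (at t)"
proof -
  let ?g = "\<lambda>z. f z * indicator S z"
  define D where "D k = (lap (restr q S) ^^ k) ?g" for k
  define c where "c z k = D k z / fact k" for k z
  define M where "M = (\<Sum>x\<in>S. \<Sum>y\<in>{y. q x y > 0}. 2 * q x y)"
  define C where "C = (\<Sum>z\<in>S. \<bar>f z\<bar>)"
  have "\<bar>?g z\<bar> \<le> C" for z
  proof (cases "z \<in> S")
    case True then show ?thesis unfolding C_def using member_le_sum[of z S "\<lambda>z. \<bar>f z\<bar>"] S by simp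
  qed (simp add: C_def sum_nonneg)
  then have bound: "\<bar>D k z\<bar> \<le> M ^ k * C" for k z
    unfolding M_def D_def by (intro funpow_lap_restr_bound q S)
  have summable: "summable (\<lambda>k. c z k * s ^ k)" for z s
  proof (rule summable_comparison_test)
    show "\<exists>N. \<forall>n\<ge>N. norm (c z n * s ^ n) \<le> C * (inverse (fact n) * (M * \<bar>s\<bar>) ^ n)"
    proof (intro exI allI impI)
      fix n
      have "\<bar>D n z\<bar> * \<bar>s\<bar> ^ n / fact n \<le> (M ^ n * C) * \<bar>s\<bar> ^ n / fact n"
        by (intro divide_right_mono mult_right_mono bound) auto
      then show "norm (c z n * s ^ n) \<le> C * (inverse (fact n) * (M * \<bar>s\<bar>) ^ n)"
        by (simp add: c_def abs_mult power_abs power_mult_distrib field_simps)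
    qed
  qed (intro summable_mult summable_exp)
  have heat_eq: "heatS q S s f z = (\<Sum>k. c z k * s ^ k)" for s z
    by (simp add: heatS_def c_def D_def mult.commute)
  \<comment> \<open>\<open>diffs\<close> raises the index by one, which applies the restricted
    Laplacian once more; at \<open>x\<close> in \<open>S\<close> it agrees with
    \<open>lap q\<close>.\<close>
  have "diffs (c x) k * t ^ k = (\<Sum>y\<in>{y. q x y > 0}. q x y * (c y k * t ^ k - c x k * t ^ k))" for k
  proof -
    have "diffs (c x) k = D (Suc k) x / fact k"
      by (simp add: diffs_def c_def field_simps del: of_nat_Suc)
    also have "D (Suc k) x = lap q (D k) x" using x by (simp add: D_def lap_restr)
    finally have "diffs (c x) k = (\<Sum>y\<in>{y. q x y > 0}. q x y * (D k y - D k x)) / fact k"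
      by (simp add: lap_def)
    then show ?thesis
      by (simp add: c_def sum_distrib_right sum_divide_distrib left_diff_distrib right_diff_distrib diff_divide_distrib mult.assoc)
  qed
  then have "(\<lambda>k. diffs (c x) k * t ^ k) sums lap q (heatS q S t f) x"
    unfolding lap_def heat_eq
    by (auto intro!: sums_sum sums_mult sums_diff summable_sums summable)
  then have "(\<Sum>k. diffs (c x) k * t ^ k) = lap q (heatS q S t f) x" by (simp add: sums_iff)
  with termdiffs_strong_converges_everywhere[of "c x" t] summable
  show ?thesis by (simp add: heat_eq)
qed

text \<open>The minimum principle for \<open>w - heatS\<close>. The semigroup vanishes off
  \<open>S\<close>, so only the sign of \<open>w\<close> matters there.\<close>

lemma heatS_le_supersolution:
  assumes q: "is_graph q" and S: "finite S"
    and deriv: "\<And>s x. 0 \<le> s \<Longrightarrow> x \<in> S \<Longrightarrow> ((\<lambda>s. w s x) has_real_derivative w' s x) (at s)"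
    and super: "\<And>s x. 0 \<le> s \<Longrightarrow> x \<in> S \<Longrightarrow> lap q (w s) x \<le> w' s x"
    and outside: "\<And>s x. 0 \<le> s \<Longrightarrow> x \<notin> S \<Longrightarrow> 0 \<le> w s x"
    and init: "\<And>x. x \<in> S \<Longrightarrow> f x \<le> w 0 x"
    and t: "0 \<le> t"
  shows "heatS q S t f x \<le> w t x"
proof -
  have "0 \<le> w t x - heatS q S t f x"
  proof (rule minimum_principle[where v = "\<lambda>t x. w t x - heatS q S t f x" and q = q and S = S
        and v' = "\<lambda>t x. w' t x - lap q (heatS q S t f) x"])
    show "((\<lambda>s. w s x - heatS q S s f x) has_real_derivative w' s x - lap q (heatS q S s f) x) (at s)"
      if "0 \<le> s" "x \<in> S" for s x
      by (intro DERIV_diff deriv heatS_deriv q S that)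
  qed (use assms in \<open>auto simp: is_graph_def lap_diff heatS_outside heatS_0\<close>)
  then show ?thesis by simp
qed

lemma heatS_ge_subsolution:
  assumes q: "is_graph q" and S: "finite S"
    and deriv: "\<And>s x. 0 \<le> s \<Longrightarrow> x \<in> S \<Longrightarrow> ((\<lambda>s. w s x) has_real_derivative w' s x) (at s)"
    and sub: "\<And>s x. 0 \<le> s \<Longrightarrow> x \<in> S \<Longrightarrow> w' s x \<le> lap q (w s) x"
    and outside: "\<And>s x. 0 \<le> s \<Longrightarrow> x \<notin> S \<Longrightarrow> w s x \<le> 0"
    and init: "\<And>x. x \<in> S \<Longrightarrow> w 0 x \<le> f x"
    and t: "0 \<le> t"
  shows "w t x \<le> heatS q S t f x"
proof -
  have "0 \<le> heatS q S t f x - w t x"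
  proof (rule minimum_principle[where v = "\<lambda>t x. heatS q S t f x - w t x" and q = q and S = S
        and v' = "\<lambda>t x. lap q (heatS q S t f) x - w' t x"])
    show "((\<lambda>s. heatS q S s f x - w s x) has_real_derivative lap q (heatS q S s f) x - w' s x) (at s)"
      if "0 \<le> s" "x \<in> S" for s x
      by (intro DERIV_diff deriv heatS_deriv q S that)
  qed (use assms in \<open>auto simp: is_graph_def lap_diff heatS_outside heatS_0\<close>)
  then show ?thesis by simp
qed

lemma heatS_nonneg:
  assumes "is_graph q" "finite S" "\<And>x. 0 \<le> f x" "0 \<le> t"
  shows "0 \<le> heatS q S t f x"
  by (rule heatS_ge_subsolution[where w = "\<lambda>_ _. 0" and w' = "\<lambda>_ _. 0"])
    (use assms in \<open>auto simp: lap_def\<close>)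

text \<open>The semigroup of the larger set solves the heat equation on \<open>S\<close> and is
  nonnegative off \<open>S\<close>, so it is a supersolution for the smaller set.\<close>

lemma heatS_mono_domain:
  assumes q: "is_graph q" and S: "finite S'" "S \<subseteq> S'" and f: "\<And>x. 0 \<le> f x" and t: "0 \<le> t"
  shows "heatS q S t f x \<le> heatS q S' t f x"
  by (rule heatS_le_supersolution[where w' = "\<lambda>t. lap q (heatS q S' t f)"])
    (use assms finite_subset[OF S(2,1)] in \<open>auto intro!: heatS_deriv heatS_nonneg simp: heatS_0 subset_iff\<close>)

section \<open>Passage to the limit over finite sets\<close>

lemma tendsto_heatI:
  "((\<lambda>S. heatS q S t f x) \<longlongrightarrow> l) (finite_subsets_at_top UNIV) \<Longrightarrow> heat q t f x = l"
  unfolding heat_def by (rule tendsto_Lim[OF finite_subsets_at_top_neq_bot])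

text \<open>\<open>Lim\<close> is meaningful only once convergence is known. The family increases
  with \<open>S\<close> and is bounded by \<open>b\<close>, hence converges to its supremum.\<close>

lemma heat_le:
  fixes q :: "'v \<Rightarrow> 'v \<Rightarrow> real"
  assumes q: "is_graph q" and f: "\<And>x. 0 \<le> f x" and t: "0 \<le> t"
    and le: "\<And>S. finite S \<Longrightarrow> heatS q S t f x \<le> b"
  shows "heat q t f x \<le> b"
proof -
  define l where "l = (SUP S\<in>{S. finite S}. heatS q S t f x)"
  have bdd: "bdd_above ((\<lambda>S. heatS q S t f x) ` {S. finite S})" using le by (auto intro!: bdd_aboveI2)
  have "((\<lambda>S. heatS q S t f x) \<longlongrightarrow> l) (finite_subsets_at_top UNIV)"
  proof (rule increasing_tendsto)
    show "\<forall>\<^sub>F S in finite_subsets_at_top UNIV. heatS q S t f x \<le> l"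
      by (rule eventually_finite_subsets_at_top_weakI) (auto simp: l_def intro!: cSUP_upper bdd)
    fix y assume "y < l"
    then obtain S where S: "finite S" "y < heatS q S t f x"
      unfolding l_def by (subst (asm) less_cSUP_iff) (auto intro: bdd)
    show "\<forall>\<^sub>F S in finite_subsets_at_top UNIV. y < heatS q S t f x"
      unfolding eventually_finite_subsets_at_top
      using S by (intro exI[of _ S]) (auto intro: less_le_trans heatS_mono_domain q f t)
  qed
  then have "heat q t f x = l" by (rule tendsto_heatI)
  also have "l \<le> b" unfolding l_def using le by (intro cSUP_least) auto
  finally show ?thesis .
qed

section \<open>Survival probabilities of the simple random walk\<close>

text \<open>Probability that the simple random walk on the integers started at \<open>n\<close> is still positive
  after \<open>m\<close> steps. The increment at \<open>k\<close> is the sum of the probabilities of moving by \<open>k\<close> and by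
  \<open>k - 1\<close> in \<open>m\<close> steps, one of which vanishes by parity.\<close>
definition walk_survival :: "nat \<Rightarrow> nat \<Rightarrow> real" where
  "walk_survival m n = (\<Sum>k=1..n. real (m choose ((m + k) div 2))) / 2 ^ m"

lemma walk_survival_0 [simp]: "walk_survival m 0 = 0"
  by (simp add: walk_survival_def)

lemma walk_survival_Suc_right:
  "walk_survival m (Suc n) = walk_survival m n + real (m choose ((m + Suc n) div 2)) / 2 ^ m"
  by (simp add: walk_survival_def add_divide_distrib)

lemma walk_survival_init: "walk_survival 0 n = indicator {0<..} n"
proof (induction n)
  case (Suc n)
  then show ?case
    by (cases n) (auto simp: walk_survival_Suc_right binomial_eq_0 simp del: of_nat_Suc)
qed simp

text \<open>Conditioning on the first step. The increments in \<open>n\<close> obey Pascal's rule,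
  which drives the induction; at the absorbing end the two middle coefficients must also agree when
  \<open>m\<close> is odd.\<close>

lemma walk_survival_step:
  "walk_survival (Suc m) (Suc n) = (walk_survival m (Suc (Suc n)) + walk_survival m n) / 2"
proof (induction n)
  case 0
  have "Suc m choose (Suc m div 2 + (if even m then 1 else 0))
      = (m choose (Suc m div 2)) + (m choose (Suc (Suc m) div 2))"
  proof (cases "even m")
    case True
    then obtain k where "m = 2 * k" by blast
    then show ?thesis by simp
  next
    case False
    then obtain k where "m = 2 * k + 1" by (rule oddE)
    moreover have "2 * k + 1 choose Suc k = 2 * k + 1 choose k"
      by (subst binomial_symmetric) auto
    ultimately show ?thesis by simp
  qed
  moreover have "(Suc m + Suc 0) div 2 = Suc m div 2 + (if even m then 1 else 0)" by auto
  ultimately show ?case by (simp add: walk_survival_Suc_right field_simps)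
next
  case (Suc n)
  have "(Suc m + Suc (Suc n)) div 2 = Suc ((m + Suc n) div 2)" by simp
  moreover have "(m + Suc (Suc (Suc n))) div 2 = Suc ((m + Suc n) div 2)" by simp
  ultimately have "Suc m choose ((Suc m + Suc (Suc n)) div 2)
      = (m choose ((m + Suc n) div 2)) + (m choose ((m + Suc (Suc (Suc n))) div 2))"
    by (simp only: binomial_Suc_Suc)
  then have pascal: "real (Suc m choose ((Suc m + Suc (Suc n)) div 2)) / 2 ^ Suc m
      = (real (m choose ((m + Suc (Suc (Suc n))) div 2)) / 2 ^ m
        + real (m choose ((m + Suc n) div 2)) / 2 ^ m) / 2"
    by (simp add: field_simps del: binomial_Suc_Suc)
  show ?case
    unfolding walk_survival_Suc_right[of "Suc m" "Suc n"] pascal Suc.IH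
      walk_survival_Suc_right[of m "Suc (Suc n)"] walk_survival_Suc_right[of m n] by argo
qed

lemma walk_survival_nonneg: "0 \<le> walk_survival m n"
  by (simp add: walk_survival_def sum_nonneg)

lemma walk_survival_le_1: "walk_survival m n \<le> 1"
proof (induction m arbitrary: n)
  case (Suc m)
  show ?case
  proof (cases n)
    case (Suc n')
    then show ?thesis using Suc.IH[of "Suc n"] Suc.IH[of n'] by (simp add: walk_survival_step)
  qed simp
qed (simp add: walk_survival_init indicator_def)

lemma walk_survival_mono: "walk_survival m n \<le> walk_survival m (Suc n)"
  by (simp add: walk_survival_Suc_right)

text \<open>From the middle index \<open>m div 2\<close> onward binomial coefficients decrease, and
  beyond \<open>m\<close> they are 0.\<close>

lemma choose_half_antimono:
  assumes "j \<le> k" shows "m choose ((m + k) div 2) \<le> m choose ((m + j) div 2)"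
proof (cases "(m + k) div 2 \<le> m")
  case True
  then show ?thesis using assms by (intro binomial_antimono) (auto intro!: div_le_mono)
qed (simp add: binomial_eq_0)

lemma walk_survival_concave:
  "walk_survival m (Suc (Suc n)) + walk_survival m n \<le> 2 * walk_survival m (Suc n)"
proof -
  have "real (m choose ((m + Suc (Suc n)) div 2)) / 2 ^ m \<le> real (m choose ((m + Suc n) div 2)) / 2 ^ m"
    by (intro divide_right_mono of_nat_mono choose_half_antimono) auto
  then show ?thesis
    using walk_survival_Suc_right[of m "Suc n"] walk_survival_Suc_right[of m n] by linarith
qed

text \<open>The increment at \<open>k = 1\<close> is the largest of the \<open>n\<close>
  increments.\<close>

lemma walk_survival_le_linear: "walk_survival m n \<le> real n * walk_survival m 1"
proof -
  have "(\<Sum>k=1..n. real (m choose ((m + k) div 2))) \<le> (\<Sum>k=1..n. real (m choose ((m + 1) div 2)))"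
    by (intro sum_mono of_nat_mono choose_half_antimono) auto
  then show ?thesis by (simp add: walk_survival_def field_simps)
qed

section \<open>Central binomial coefficients and survival from 1\<close>

lemma central_binomial_Suc: "Suc k * (2 * Suc k choose Suc k) = 2 * (2 * k + 1) * (2 * k choose k)"
proof -
  have "Suc k * (2 * Suc k choose Suc k) = 2 * (Suc k * (2 * k + 1 choose Suc k))"
  proof -
    have "2 * Suc k choose Suc k = (2 * k + 1 choose k) + (2 * k + 1 choose Suc k)" by simp
    moreover have "2 * k + 1 choose k = 2 * k + 1 choose Suc k" by (subst binomial_symmetric) auto
    ultimately show ?thesis by simp
  qed
  also have "Suc k * (2 * k + 1 choose Suc k) = (2 * k + 1) * (2 * k choose k)"
    using Suc_times_binomial[of k "2 * k"] by simp
  finally show ?thesis by (simp add: algebra_simps)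
qed

text \<open>The left side is nonincreasing in \<open>k\<close>: consecutive values have ratio
  \<open>(2k+1)(2k+3) / (2k+2)^2\<close>, which is below 1.\<close>

lemma central_binomial_upper: "(real (2 * k choose k) / 4 ^ k)\<^sup>2 * real (2 * k + 1) \<le> 1"
proof (induction k)
  case (Suc k)
  let ?b = "\<lambda>k. real (2 * k choose k) / 4 ^ k"
  have "real (Suc k) * real (2 * Suc k choose Suc k) = 2 * real (2 * k + 1) * real (2 * k choose k)"
    using central_binomial_Suc[of k] unfolding of_nat_mult[symmetric] by (metis of_nat_mult of_nat_numeral)
  moreover have "?b (Suc k) * real (2 * k + 2) = 2 * (real (Suc k) * real (2 * Suc k choose Suc k)) / 4 ^ Suc k"
    by (simp add: field_simps del: binomial_Suc_Suc)
  ultimately have "?b (Suc k) * real (2 * k + 2) = 2 * (2 * real (2 * k + 1) * real (2 * k choose k)) / 4 ^ Suc k"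
    by (simp only:)
  also have "\<dots> = ?b k * real (2 * k + 1)" by (simp add: field_simps)
  finally have "?b (Suc k) * real (2 * k + 2) = ?b k * real (2 * k + 1)" .
  then have step: "?b (Suc k) = ?b k * (real (2 * k + 1) / real (2 * k + 2))"
    by (simp add: eq_divide_eq del: binomial_Suc_Suc)
  have "(?b (Suc k))\<^sup>2 * real (2 * Suc k + 1)
      = ((?b k)\<^sup>2 * real (2 * k + 1)) * (real (2 * k + 1) * real (2 * k + 3) / (real (2 * k + 2))\<^sup>2)"
    unfolding step by (simp add: power2_eq_square field_simps)
  also have "\<dots> \<le> 1 * 1"
  proof (intro mult_mono Suc.IH)
    show "real (2 * k + 1) * real (2 * k + 3) / (real (2 * k + 2))\<^sup>2 \<le> 1"
      by (intro divide_le_eq_1_pos[THEN iffD2]) (auto simp: power2_eq_square algebra_simps intro: add_pos_nonneg)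
  qed auto
  finally show ?case by simp
qed simp

text \<open>For even \<open>m\<close> this is a normalized central coefficient. For odd
  \<open>m\<close> it equals the next one, because the two middle coefficients of row
  \<open>m\<close> coincide and add up to the central one of row \<open>m + 1\<close>.\<close>

lemma walk_survival_1_le: "walk_survival m 1 \<le> 1 / sqrt (real (Suc m))"
proof -
  let ?b = "\<lambda>k. real (2 * k choose k) / 4 ^ k"
  have b: "?b k \<le> 1 / sqrt (real (2 * k + 1))" for k
  proof -
    have "(?b k * sqrt (real (2 * k + 1)))\<^sup>2 \<le> 1\<^sup>2"
      using central_binomial_upper[of k] by (simp add: power_mult_distrib power_divide)
    then have "?b k * sqrt (real (2 * k + 1)) \<le> 1" by (rule power2_le_imp_le) simp
    then show ?thesis by (simp add: le_divide_eq)
  qed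
  have w: "walk_survival m 1 = real (m choose (Suc m div 2)) / 2 ^ m"
    by (simp add: walk_survival_def)
  show ?thesis
  proof (cases "even m")
    case True
    then obtain k where "m = 2 * k" by blast
    then show ?thesis using b[of k] unfolding w by (simp add: power_mult)
  next
    case False
    then obtain k where k: "m = 2 * k + 1" by (rule oddE)
    have "2 * Suc k choose Suc k = (2 * k + 1 choose k) + (2 * k + 1 choose Suc k)" by simp
    moreover have "2 * k + 1 choose k = 2 * k + 1 choose Suc k" by (subst binomial_symmetric) auto
    ultimately have "2 * (m choose (Suc m div 2)) = 2 * Suc k choose Suc k" using k by simp
    then have "real (m choose (Suc m div 2)) = real (2 * Suc k choose Suc k) / 2"
      by (metis of_nat_mult of_nat_numeral nonzero_mult_div_cancel_left zero_neq_numeral)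
    moreover have "(2::real) ^ m = 4 ^ Suc k / 2" by (simp add: k power_mult)
    ultimately have "walk_survival m 1 = ?b (Suc k)"
      unfolding w by (simp add: field_simps del: binomial_Suc_Suc)
    also have "\<dots> \<le> 1 / sqrt (real (2 * Suc k + 1))" by (rule b)
    also have "\<dots> \<le> 1 / sqrt (real (Suc m))" unfolding k by (intro divide_left_mono) auto
    finally show ?thesis .
  qed
qed

text \<open>The same for the walk that jumps at rate 1, by averaging over the Poisson number of jumps.\<close>
definition survival :: "real \<Rightarrow> nat \<Rightarrow> real" where
  "survival s n = exp (- s) * (\<Sum>m. walk_survival m n / fact m * s ^ m)"

lemma summable_exp_weighted:
  assumes "\<And>m. \<bar>a m\<bar> \<le> (1::real)"
  shows "summable (\<lambda>m. a m / fact m * s ^ m)"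
proof (rule summable_comparison_test)
  have "\<bar>a m\<bar> * \<bar>s\<bar> ^ m / fact m \<le> 1 * \<bar>s\<bar> ^ m / fact m" for m
    by (intro divide_right_mono mult_right_mono assms) auto
  then show "\<exists>N. \<forall>m\<ge>N. norm (a m / fact m * s ^ m) \<le> inverse (fact m) * \<bar>s\<bar> ^ m"
    by (auto simp: abs_mult power_abs field_simps)
qed (rule summable_exp)

lemma abs_walk_survival_le_1: "\<bar>walk_survival m n\<bar> \<le> 1"
  using walk_survival_nonneg[of m n] walk_survival_le_1[of m n] by simp

lemma summable_walk_survival: "summable (\<lambda>m. walk_survival m n / fact m * s ^ m)"
  by (intro summable_exp_weighted abs_walk_survival_le_1)

lemma survival_at_0 [simp]: "survival s 0 = 0"
  by (simp add: survival_def)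

lemma survival_init: "survival 0 n = indicator {0<..} n"
  using powser_zero[of "\<lambda>m. walk_survival m n / fact m"] by (simp add: survival_def walk_survival_init)

text \<open>Differentiating the series raises \<open>m\<close> by one, where
  \<open>walk_survival_step\<close> applies; the factor \<open>exp (- s)\<close> contributes the
  negative term.\<close>

lemma survival_deriv:
  "((\<lambda>s. survival s (Suc n)) has_real_derivative
     (survival s (Suc (Suc n)) + survival s n) / 2 - survival s (Suc n)) (at s)"
proof -
  let ?c = "\<lambda>n m. walk_survival m n / fact m"
  let ?G = "\<lambda>n s. \<Sum>m. ?c n m * s ^ m"
  have "diffs (?c (Suc n)) m * s ^ m = (?c (Suc (Suc n)) m * s ^ m + ?c n m * s ^ m) / 2" for m
  proof -
    have "diffs (?c (Suc n)) m = walk_survival (Suc m) (Suc n) / fact m"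
      by (simp add: diffs_def field_simps del: of_nat_Suc)
    then show ?thesis by (simp add: walk_survival_step add_divide_distrib distrib_right)
  qed
  then have "(\<lambda>m. diffs (?c (Suc n)) m * s ^ m) sums ((?G (Suc (Suc n)) s + ?G n s) / 2)"
    by (simp only:) (intro sums_divide sums_add summable_sums summable_walk_survival)
  then have "(\<Sum>m. diffs (?c (Suc n)) m * s ^ m) = (?G (Suc (Suc n)) s + ?G n s) / 2"
    by (simp add: sums_iff)
  with termdiffs_strong_converges_everywhere[of "?c (Suc n)" s] summable_walk_survival
  have "(?G (Suc n) has_real_derivative (?G (Suc (Suc n)) s + ?G n s) / 2) (at s)" by simp
  then have "((\<lambda>s. exp (- s) * ?G (Suc n) s) has_real_derivative
      exp (- s) * ((?G (Suc (Suc n)) s + ?G n s) / 2) + - exp (- s) * ?G (Suc n) s) (at s)"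
    by (auto intro!: derivative_eq_intros)
  then show ?thesis by (simp add: survival_def[abs_def] algebra_simps add_divide_distrib)
qed

lemma exp_series_sums: "(\<lambda>m. s ^ m / fact m) sums exp (s::real)"
  using exp_converges[of s] by (simp add: scaleR_conv_of_real field_simps)

text \<open>\<open>exp (- s) * B\<close> is the mean of \<open>b\<close> under the Poisson law with
  parameter \<open>s\<close>.\<close>

lemma survival_le_weighted:
  assumes s: "0 \<le> s" and le: "\<And>m. walk_survival m n \<le> b m"
    and b: "(\<lambda>m. b m * (s ^ m / fact m)) sums B"
  shows "survival s n \<le> exp (- s) * B"
proof -
  have "(\<Sum>m. walk_survival m n / fact m * s ^ m) \<le> (\<Sum>m. b m * (s ^ m / fact m))"
  proof (rule suminf_le)
    show "walk_survival m n / fact m * s ^ m \<le> b m * (s ^ m / fact m)" for m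
      using mult_right_mono[OF le, of "s ^ m / fact m" m] s by simp
  qed (use b summable_walk_survival in \<open>auto simp: sums_iff\<close>)
  then show ?thesis using b by (simp add: survival_def sums_iff)
qed

lemma survival_nonneg: "0 \<le> s \<Longrightarrow> 0 \<le> survival s n"
  unfolding survival_def
  by (intro mult_nonneg_nonneg suminf_nonneg summable_walk_survival divide_nonneg_nonneg walk_survival_nonneg) auto

lemma survival_le_1: "0 \<le> s \<Longrightarrow> survival s n \<le> 1"
  using survival_le_weighted[of s n "\<lambda>_. 1" "exp s"] walk_survival_le_1 exp_series_sums[of s]
  by (simp flip: exp_add)

text \<open>Poisson averaging is linear and positive. Monotonicity, concavity and the linear bound
  for \<open>survival\<close> are all instances.\<close>

lemma survival_linear_combination_nonneg:
  assumes s: "0 \<le> s" and nn: "\<And>m. 0 \<le> a * walk_survival m i + b * walk_survival m j + c * walk_survival m k"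
  shows "0 \<le> a * survival s i + b * survival s j + c * survival s k"
proof -
  let ?w = "\<lambda>n m. walk_survival m n / fact m * s ^ m"
  have sum: "(\<lambda>m. a * ?w i m + b * ?w j m + c * ?w k m) sums (a * suminf (?w i) + b * suminf (?w j) + c * suminf (?w k))"
    by (intro sums_add sums_mult summable_sums summable_walk_survival)
  have "a * ?w i m + b * ?w j m + c * ?w k m
      = (a * walk_survival m i + b * walk_survival m j + c * walk_survival m k) * (s ^ m / fact m)" for m
    by (simp add: algebra_simps add_divide_distrib)
  then have "0 \<le> a * suminf (?w i) + b * suminf (?w j) + c * suminf (?w k)"
    using s nn by (intro sums_le[OF _ sums_zero sum]) (simp only: mult_nonneg_nonneg zero_le_divide_iff zero_le_power fact_ge_zero simp_thms)
  then have "0 \<le> exp (- s) * (a * suminf (?w i) + b * suminf (?w j) + c * suminf (?w k))" by simp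
  then show ?thesis by (simp add: survival_def algebra_simps)
qed

lemma survival_mono: "0 \<le> s \<Longrightarrow> survival s n \<le> survival s (Suc n)"
  using survival_linear_combination_nonneg[of s 1 "Suc n" "-1" n 0 0] walk_survival_mono by simp

lemma survival_concave: "0 \<le> s \<Longrightarrow> survival s (Suc (Suc n)) + survival s n \<le> 2 * survival s (Suc n)"
  using survival_linear_combination_nonneg[of s 2 "Suc n" "-1" "Suc (Suc n)" "-1" n] walk_survival_concave
  by (simp add: algebra_simps)

lemma survival_le_linear: "0 \<le> s \<Longrightarrow> survival s n \<le> real n * survival s 1"
  using survival_linear_combination_nonneg[of s "real n" 1 "-1" n 0 0] walk_survival_le_linear by simp

text \<open>The linear bound reduces this to \<open>n = 1\<close>. There
  \<open>1 / sqrt (m + 1)\<close> is majorized by \<open>b m\<close>, which is affine in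
  \<open>1 / (m + 1)\<close> and so has an explicit Poisson mean.\<close>

lemma survival_le:
  assumes s: "0 < s"
  shows "survival s n \<le> real n / sqrt s"
proof -
  define b where "b m = (sqrt s / real (Suc m) + 1 / sqrt s) / 2" for m
  have "1 / sqrt (real (Suc m)) \<le> b m" for m
  proof -
    \<comment> \<open>AM-GM for \<open>sqrt s / (m + 1)\<close> and \<open>1 / sqrt s\<close>; it replaces Jensen's inequality for the Poisson average.\<close>
    define u where "u = sqrt (sqrt s)"
    define r where "r = sqrt (real (Suc m))"
    have u: "0 < u" "sqrt s = u\<^sup>2" using s by (auto simp: u_def)
    have r: "0 < r" "real (Suc m) = r\<^sup>2" by (auto simp: r_def)
    have "0 \<le> (u / r - 1 / u)\<^sup>2" by simp
    also have "\<dots> = u\<^sup>2 / r\<^sup>2 + 1 / u\<^sup>2 - 2 * (1 / r)"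
      using u(1) r(1) by (simp add: power2_diff power_divide)
    finally show ?thesis unfolding b_def u(2) r(2) using r(1) by (simp add: real_sqrt_abs)
  qed
  then have le: "walk_survival m 1 \<le> b m" for m using walk_survival_1_le order_trans by blast
  \<comment> \<open>The shifted exponential series yields the Poisson mean
    \<open>(1 - exp (- s)) / s\<close> of \<open>1 / (m + 1)\<close>.\<close>
  have "(\<lambda>m. s ^ Suc m / fact (Suc m)) sums (exp s - 1)"
    using exp_series_sums[of s] by (subst sums_Suc_iff) simp
  from sums_divide[OF this, of s] have "(\<lambda>m. s ^ m / fact (Suc m)) sums ((exp s - 1) / s)"
    using s by (simp add: mult.commute[of s] del: fact_Suc)
  then have "(\<lambda>m. sqrt s / 2 * (s ^ m / fact (Suc m)) + 1 / (2 * sqrt s) * (s ^ m / fact m)) sums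
      (sqrt s / 2 * ((exp s - 1) / s) + 1 / (2 * sqrt s) * exp s)"
    by (intro sums_add sums_mult exp_series_sums)
  also have "(\<lambda>m. sqrt s / 2 * (s ^ m / fact (Suc m)) + 1 / (2 * sqrt s) * (s ^ m / fact m))
      = (\<lambda>m. b m * (s ^ m / fact m))"
    using s by (auto simp: b_def field_simps simp del: of_nat_Suc)
  finally have "survival s 1 \<le> exp (- s) * (sqrt s / 2 * ((exp s - 1) / s) + 1 / (2 * sqrt s) * exp s)"
    using s le by (intro survival_le_weighted) auto
  also have "\<dots> = (1 - exp (- s)) / (2 * sqrt s) + 1 / (2 * sqrt s)"
  proof -
    define u where "u = sqrt s"
    have u: "0 < u" "s = u * u" using s by (auto simp: u_def)
    have "exp (- s) * (u / 2 * ((exp s - 1) / (u * u)) + 1 / (2 * u) * exp s)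
        = (2 * (exp (- s) * exp s) - exp (- s)) / (2 * u)"
      using u(1) by (simp add: field_simps)
    also have "exp (- s) * exp s = 1" by (simp flip: exp_add)
    finally show ?thesis using u(1) by (simp add: u_def[symmetric] u(2)[symmetric] add_divide_distrib diff_divide_distrib)
  qed
  also have "\<dots> \<le> 1 / sqrt s"
    using s by (simp add: field_simps)
  finally have "real n * survival s 1 \<le> real n * (1 / sqrt s)" by (rule mult_left_mono) simp
  with survival_le_linear[of s n] s show ?thesis by simp
qed

section \<open>The comparison function\<close>

lemma lap_q0:
  "lap (q0 c) f n = (if 0 < n \<and> 0 < c then 2 * c * (f (Suc n) + f (n - 1) - 2 * f n) else 0)"
proof (cases "0 < n \<and> 0 < c")
  case True
  then have "{y. q0 c n y > 0} = {Suc n, n - 1}" by (auto simp: q0_def)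
  then show ?thesis using True by (simp add: lap_def q0_def algebra_simps)
next
  case False
  then have "{y. q0 c n y > 0} = {}" by (auto simp: q0_def)
  then show ?thesis using False by (simp only: lap_def sum.empty if_False)
qed

lemma is_graph_q0: "0 \<le> c \<Longrightarrow> is_graph (q0 c)"
  unfolding is_graph_def
proof (intro conjI allI)
  show "finite {y. 0 < q0 c x y}" for x
    by (rule finite_subset[of _ "{Suc x, x - 1}"]) (auto simp: q0_def split: if_splits)
qed (simp add: q0_def)

text \<open>The factor \<open>4 * c\<close> is the total jump rate, \<open>2 * c\<close> to each of
  the two neighbours, while \<open>survival\<close> runs at rate 1.\<close>

lemma survival_scaled_deriv:
  assumes "0 < n" "0 \<le> c"
  shows "((\<lambda>t. survival (4 * c * t) n) has_real_derivative
    2 * c * (survival (4 * c * t) (Suc n) + survival (4 * c * t) (n - 1) - 2 * survival (4 * c * t) n)) (at t)"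
proof -
  obtain k where n: "n = Suc k" using assms gr0_conv_Suc by blast
  have "((\<lambda>t. 4 * c * t) has_real_derivative 4 * c) (at t)" by (auto intro!: derivative_eq_intros)
  from DERIV_chain2[OF survival_deriv this, of k] show ?thesis
    unfolding n by (rule DERIV_cong) (simp add: field_simps)
qed

lemma survival_0_deriv: "((\<lambda>t. survival (g t) 0) has_real_derivative 0) (at t)"
  by simp

lemma survival_heat_equation:
  assumes "0 \<le> c"
  shows "((\<lambda>t. survival (4 * c * t) n) has_real_derivative
    lap (q0 c) (survival (4 * c * t)) n) (at t)"
  using survival_scaled_deriv[of n c t] assms survival_0_deriv
  by (cases "n = 0"; cases "c = 0") (auto simp: lap_q0)

text \<open>The Dirichlet semigroups are squeezed between \<open>survival\<close> and
  \<open>survival\<close> minus a harmonic function that becomes small as the finite sets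
  grow.\<close>

lemma phi_eq_survival:
  assumes t: "0 \<le> t"
  shows "phi c t n = survival (4 * max c 0 * t) n"
proof -
  define c' where "c' = max c 0"
  have c': "0 \<le> c'" by (simp add: c'_def)
  define w where "w s = survival (4 * c' * s)" for s
  note graph = is_graph_q0[OF c']
  let ?f = "indicator {0<..} :: nat \<Rightarrow> real"
  \<comment> \<open>A negative \<open>c\<close> gives no positive rates, hence the same zero
    Laplacian as \<open>c = 0\<close>.\<close>
  have "lap (restr (q0 c) S) = lap (restr (q0 c') S)" for S
    by (intro ext) (simp add: lap_restr lap_q0 c'_def)
  then have heatS_eq: "heatS (q0 c) S = heatS (q0 c') S" for S
    by (simp add: heatS_def[abs_def])
  have deriv: "((\<lambda>s. w s n) has_real_derivative lap (q0 c') (w s) n) (at s)" for s n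
    unfolding w_def by (rule survival_heat_equation[OF c'])
  have upper: "heatS (q0 c') S t ?f n \<le> w t n" if "finite S" for S
    by (rule heatS_le_supersolution[OF graph that deriv])
      (use t c' in \<open>auto simp: w_def survival_nonneg survival_init\<close>)
  \<comment> \<open>The linear function is harmonic and dominates \<open>w\<close> outside \<open>{..N}\<close>.\<close>
  have lower: "w t n - real n / real (Suc N) \<le> heatS (q0 c') S t ?f n"
    if "finite S" "{..N} \<subseteq> S" for S N
  proof (rule heatS_ge_subsolution[OF graph that(1)])
    show "((\<lambda>s. w s n - real n / real (Suc N)) has_real_derivative lap (q0 c') (w s) n) (at s)" for s n
      using DERIV_diff[OF deriv DERIV_const] by simp
    show "lap (q0 c') (w s) n \<le> lap (q0 c') (\<lambda>n. w s n - real n / real (Suc N)) n" for s n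
    proof -
      have "lap (q0 c') (\<lambda>n. real n / real (Suc N)) n = 0"
        by (auto simp: lap_q0 of_nat_diff field_simps simp del: of_nat_Suc)
          (auto simp: algebra_simps of_nat_diff)
      then show ?thesis by (simp add: lap_diff)
    qed
    show "w s n - real n / real (Suc N) \<le> 0" if "0 \<le> s" "n \<notin> S" for s n
    proof -
      have "n \<notin> {..N}" using \<open>{..N} \<subseteq> S\<close> that by blast
      then have "Suc N \<le> n" by simp
      then have "1 \<le> real n / real (Suc N)" by (simp add: le_divide_eq del: of_nat_Suc)
      moreover have "w s n \<le> 1" using that c' by (simp add: w_def survival_le_1)
      ultimately show ?thesis by linarith
    qed
  qed (use t in \<open>auto simp: w_def survival_init\<close>)
  have "((\<lambda>S. heatS (q0 c) S t ?f n) \<longlongrightarrow> w t n) (finite_subsets_at_top UNIV)"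
  proof (rule tendstoI)
    fix e :: real assume e: "0 < e"
    obtain N :: nat where N: "real n / e < real N" using reals_Archimedean2 by blast
    have "dist (heatS (q0 c) S t ?f n) (w t n) < e" if S: "finite S" "{..N} \<subseteq> S" for S
    proof -
      have "real n < e * real (Suc N)" using N e by (simp add: divide_less_eq algebra_simps)
      then have "real n / real (Suc N) < e" by (simp add: divide_less_eq del: of_nat_Suc)
      then show ?thesis using lower[OF S] upper[OF S(1)] by (simp add: heatS_eq dist_real_def)
    qed
    then show "\<forall>\<^sub>F S in finite_subsets_at_top UNIV. dist (heatS (q0 c) S t ?f n) (w t n) < e"
      unfolding eventually_finite_subsets_at_top by (intro exI[of _ "{..N}"]) auto
  qed
  then show ?thesis by (simp add: phi_def tendsto_heatI w_def c'_def)
qed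

section \<open>Potentials and curvature\<close>

lemma relpow_sym: "sym r \<Longrightarrow> sym (r ^^ n)"
proof (induction n)
  case (Suc n)
  then show ?case unfolding sym_def by (metis relpow_Suc_E relpow_Suc_I2)
qed (simp add: sym_Id)

locale reversible_connected_graph =
  fixes q :: "'v \<Rightarrow> 'v \<Rightarrow> real"
  assumes graph: "is_graph q" and reversible: "reversible q" and connected: "graph_connected q"
begin

abbreviation d :: "'v \<Rightarrow> 'v \<Rightarrow> real" where
  "d x y \<equiv> real (gdist q x y)"

lemma q_nonneg: "0 \<le> q x y"
  using graph by (simp add: is_graph_def)

lemma gdist_path: "(x, y) \<in> adj q ^^ gdist q x y"
proof -
  have "(x, y) \<in> (adj q)\<^sup>*" using connected by (simp add: graph_connected_def)
  then show ?thesis unfolding gdist_def by (metis LeastI rtrancl_imp_relpow)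
qed

lemma gdist_le: "(x, y) \<in> adj q ^^ n \<Longrightarrow> gdist q x y \<le> n"
  unfolding gdist_def by (rule Least_le)

lemma gdist_self [simp]: "gdist q x x = 0"
  using gdist_le[of x x 0] by simp

lemma gdist_eq_0_iff [simp]: "gdist q x y = 0 \<longleftrightarrow> x = y"
  using gdist_path[of x y] by auto

lemma gdist_pos: "x \<noteq> y \<Longrightarrow> 0 < gdist q x y"
  by (rule gr0I) simp

text \<open>Reversibility makes positivity of rates symmetric, so paths can be reversed.\<close>

lemma gdist_commute: "gdist q x y = gdist q y x"
proof -
  obtain m where "\<And>x. 0 < m x" "\<And>x y. q x y * m x = q y x * m y"
    using reversible by (auto simp: reversible_def)
  then have "0 < q x y \<longleftrightarrow> 0 < q y x" for x y by (metis zero_less_mult_pos2 mult_pos_pos)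
  then have "sym (adj q ^^ n)" for n by (intro relpow_sym) (auto simp: adj_def sym_def)
  then have "gdist q y x \<le> gdist q x y" for x y
    using gdist_path[of x y] by (intro gdist_le) (blast dest: symD)
  then show ?thesis by (metis order.antisym)
qed

lemma gdist_triangle: "gdist q x z \<le> gdist q x y + gdist q y z"
  by (rule gdist_le) (use gdist_path in \<open>auto simp: relpow_add\<close>)

lemma d_triangle: "d x z \<le> d x y + d y z"
  using gdist_triangle[of x z y] by (simp flip: of_nat_add)

lemma lipschitz_abs:
  assumes "\<And>x y. f y \<le> f x + d x y"
  shows "\<bar>f x - f y\<bar> \<le> d x y"
  using assms[of x y] assms[of y x] gdist_commute[of x y] by (simp add: abs_le_iff)

lemma grad_sup_eq_1:
  assumes lip: "\<And>x y. f y \<le> f x + d x y" and "x \<noteq> y" and tight: "f y = f x + d x y"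
  shows "grad_sup q f = 1"
  unfolding grad_sup_def
proof (rule antisym)
  have "\<bar>grad q a b f\<bar> \<le> 1" if "a \<noteq> b" for a b
    using lipschitz_abs[OF lip, of a b] that by (simp add: grad_def divide_le_eq)
  then show "(SUP p\<in>{(x, y). x \<noteq> y}. ereal \<bar>grad q (fst p) (snd p) f\<bar>) \<le> 1"
    by (intro SUP_least) (auto simp: one_ereal_def)
  have "\<bar>grad q x y f\<bar> = 1" using \<open>x \<noteq> y\<close> tight by (simp add: grad_def)
  then show "1 \<le> (SUP p\<in>{(x, y). x \<noteq> y}. ereal \<bar>grad q (fst p) (snd p) f\<bar>)"
    using \<open>x \<noteq> y\<close> by (intro SUP_upper2[of "(x, y)"]) auto
qed

text \<open>A 1-Lipschitz \<open>f\<close> of full slope between \<open>x\<close> and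
  \<open>y\<close> is admissible in the infimum defining the curvature.\<close>

lemma lap_le_of_tight_potential:
  assumes curv: "nonneg_curvature q" and "x \<noteq> y"
    and lip: "\<And>x y. f y \<le> f x + d x y" and tight: "f y = f x + d x y"
  shows "lap q f y \<le> lap q f x"
proof -
  have "grad q y x f = 1"
    using tight \<open>x \<noteq> y\<close> gdist_commute[of x y] by (simp add: grad_def)
  with grad_sup_eq_1[OF lip \<open>x \<noteq> y\<close> tight]
  have "ollivier q x y \<le> ereal (grad q x y (lap q f))"
    unfolding ollivier_def by (intro INF_lower) simp
  with curv \<open>x \<noteq> y\<close> have "0 \<le> ereal (grad q x y (lap q f))"
    unfolding nonneg_curvature_def by (blast intro: order_trans)
  then show ?thesis using \<open>x \<noteq> y\<close> by (simp add: grad_def zero_le_divide_iff)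
qed

end

section \<open>Optimal plans and duality\<close>

lemma has_sum_point: "((\<lambda>p. of_bool (p = a) * g p) has_sum (g a :: real)) UNIV"
proof -
  have "((\<lambda>p. of_bool (p = a) * g p) has_sum g a) UNIV \<longleftrightarrow> (g has_sum g a) {a}"
    by (rule has_sum_cong_neutral) auto
  then show ?thesis using has_sum_finite[of "{a}" g] by simp
qed

lemma has_sum_diff:
  fixes f g :: "'a \<Rightarrow> real"
  assumes "(f has_sum a) A" "(g has_sum b) A"
  shows "((\<lambda>x. f x - g x) has_sum (a - b)) A"
  using has_sum_add[OF assms(1) has_sum_cmult_right[OF assms(2), of "-1"]] by simp

lemma has_sum_support:
  fixes \<rho> :: "'a \<Rightarrow> real"
  assumes "\<And>p. 0 \<le> \<rho> p" "finite {p. 0 < \<rho> p}"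
  shows "((\<lambda>p. \<rho> p * g p) has_sum (\<Sum>p\<in>{p. 0 < \<rho> p} \<inter> A. \<rho> p * g p)) A"
proof -
  have "((\<lambda>p. \<rho> p * g p) has_sum s) A \<longleftrightarrow> ((\<lambda>p. \<rho> p * g p) has_sum s) ({p. 0 < \<rho> p} \<inter> A)" for s
    by (rule has_sum_cong_neutral) (use assms(1) in \<open>auto simp: not_less intro: antisym\<close>)
  then show ?thesis using assms(2) by simp
qed

context reversible_connected_graph
begin

text \<open>\<open>\<eta>\<close> is a change of transport plan that removes mass only from \<open>A\<close>, moves a unit of first
  marginal from \<open>x\<close> to \<open>x0\<close> and changes the transport distance by \<open>c\<close>.\<close>
definition rerouting :: "('v \<times> 'v) set \<Rightarrow> 'v \<Rightarrow> 'v \<Rightarrow> ('v \<times> 'v \<Rightarrow> real) \<Rightarrow> real \<Rightarrow> bool" where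
  "rerouting A x0 x \<eta> c \<longleftrightarrow>
     (\<forall>p. p \<notin> A \<longrightarrow> 0 \<le> \<eta> p) \<and>
     (\<forall>a. ((\<lambda>b. \<eta> (a, b)) has_sum (of_bool (a = x0) - of_bool (a = x))) UNIV) \<and>
     (\<forall>b. ((\<lambda>a. \<eta> (a, b)) has_sum 0) UNIV) \<and>
     (\<eta> has_sum 0) UNIV \<and>
     ((\<lambda>p. \<eta> p * d (fst p) (snd p)) has_sum c) UNIV"

lemma rerouting_start: "rerouting A x0 x0 (\<lambda>_. 0) 0"
  by (simp add: rerouting_def)

text \<open>A unit of mass moves from \<open>(a, b)\<close> to \<open>(x, b)\<close>: column
  \<open>b\<close> is unchanged, the deficit of row \<open>x\<close> is filled, and row
  \<open>a\<close> now has the deficit.\<close>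

lemma rerouting_step:
  assumes \<eta>: "rerouting A x0 x \<eta> c" and mem: "(a, b) \<in> A"
  shows "rerouting A x0 a (\<lambda>p. \<eta> p + of_bool (p = (x, b)) - of_bool (p = (a, b))) (c + d x b - d a b)"
  unfolding rerouting_def
proof (intro conjI allI impI)
  show "0 \<le> \<eta> p + of_bool (p = (x, b)) - of_bool (p = (a, b))" if "p \<notin> A" for p
  proof -
    have "0 \<le> \<eta> p" "p \<noteq> (a, b)" using \<eta> mem that unfolding rerouting_def by blast+
    then show ?thesis by simp
  qed
  have row: "((\<lambda>b'. of_bool ((a', b') = (z, b))) has_sum (of_bool (a' = z) :: real)) UNIV" for a' z
    using has_sum_point[of b "\<lambda>_. of_bool (a' = z)"] by (simp add: of_bool_conj mult.commute)
  have col: "((\<lambda>a'. of_bool ((a', b') = (z, b))) has_sum (of_bool (b' = b) :: real)) UNIV" for b' z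
    using has_sum_point[of z "\<lambda>_. of_bool (b' = b)"] by (simp add: of_bool_conj)
  have \<eta>_row: "((\<lambda>b'. \<eta> (a', b')) has_sum (of_bool (a' = x0) - of_bool (a' = x))) UNIV"
    and \<eta>_col: "((\<lambda>a'. \<eta> (a', b')) has_sum 0) UNIV"
    and \<eta>_total: "(\<eta> has_sum 0) UNIV"
    and \<eta>_cost: "((\<lambda>p. \<eta> p * d (fst p) (snd p)) has_sum c) UNIV" for a' b'
    using \<eta> unfolding rerouting_def by blast+
  show "((\<lambda>b'. \<eta> (a', b') + of_bool ((a', b') = (x, b)) - of_bool ((a', b') = (a, b)))
      has_sum (of_bool (a' = x0) - of_bool (a' = a))) UNIV" for a'
    using has_sum_diff[OF has_sum_add[OF \<eta>_row[of a'] row[of a' x]] row[of a' a]] by simp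
  show "((\<lambda>a'. \<eta> (a', b') + of_bool ((a', b') = (x, b)) - of_bool ((a', b') = (a, b)))
      has_sum 0) UNIV" for b'
    using has_sum_diff[OF has_sum_add[OF \<eta>_col[of b'] col[of b' x]] col[of b' a]] by simp
  show "((\<lambda>p. \<eta> p + of_bool (p = (x, b)) - of_bool (p = (a, b))) has_sum 0) UNIV"
    using has_sum_diff[OF has_sum_add[OF \<eta>_total has_sum_point[of "(x, b)" "\<lambda>_. 1"]]
        has_sum_point[of "(a, b)" "\<lambda>_. 1"]] by simp
  show "((\<lambda>p. (\<eta> p + of_bool (p = (x, b)) - of_bool (p = (a, b))) * d (fst p) (snd p))
      has_sum (c + d x b - d a b)) UNIV"
    using has_sum_diff[OF has_sum_add[OF \<eta>_cost has_sum_point[of "(x, b)" "\<lambda>p. d (fst p) (snd p)"]]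
        has_sum_point[of "(a, b)" "\<lambda>p. d (fst p) (snd p)"]]
    by (simp add: left_diff_distrib distrib_right)
qed

text \<open>A closed rerouting preserves both marginals, so a small multiple of it can be added to
  the plan; optimality forbids a gain.\<close>

lemma closed_rerouting_cost_nonneg:
  assumes opt: "optimal_plan q x0 y0 \<rho>" and fin: "finite {p. 0 < \<rho> p}"
    and \<eta>: "rerouting (insert (x0, y0) {p. 0 < \<rho> p}) x0 x0 \<eta> c"
  shows "0 \<le> c"
proof -
  let ?A = "insert (x0, y0) {p. 0 < \<rho> p}"
  let ?w = "\<lambda>p. d x0 y0 - d (fst p) (snd p)"
  have plan: "transport_plan q x0 y0 \<rho>" using opt by (simp add: optimal_plan_def)
  then have \<rho>: "\<And>p. 0 \<le> \<rho> p" unfolding transport_plan_def by blast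
  \<comment> \<open>The mass at \<open>(x0, y0)\<close> is unconstrained and free of cost.\<close>
  define \<rho>1 where "\<rho>1 p = \<rho> p + of_bool (p = (x0, y0))" for p
  have \<rho>1: "0 < \<rho>1 p" if "p \<in> ?A" for p
    using that \<rho>[of p] by (auto simp: \<rho>1_def intro: add_nonneg_pos add_pos_nonneg)
  \<comment> \<open>Small enough that \<open>e * \<bar>\<eta> p\<bar>\<close> never exceeds the
    available mass; the summand 1 avoids division by 0.\<close>
  define e where "e = Min ((\<lambda>p. \<rho>1 p / (1 + \<bar>\<eta> p\<bar>)) ` ?A)"
  have e: "0 < e" unfolding e_def using fin \<rho>1
    by (subst Min_gr_iff) (auto intro!: divide_pos_pos add_pos_nonneg simp del: insert_iff)
  define \<rho>2 where "\<rho>2 p = \<rho>1 p + e * \<eta> p" for p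
  have \<rho>2: "0 \<le> \<rho>2 p" for p
  proof (cases "p \<in> ?A")
    case True
    then have "e \<le> \<rho>1 p / (1 + \<bar>\<eta> p\<bar>)" unfolding e_def using fin by (intro Min_le) auto
    then have "e * (1 + \<bar>\<eta> p\<bar>) \<le> \<rho>1 p" by (simp add: le_divide_eq add_pos_nonneg)
    moreover have "e * (- \<bar>\<eta> p\<bar>) \<le> e * \<eta> p" using e by (intro mult_left_mono) auto
    ultimately show ?thesis using e by (simp add: \<rho>2_def algebra_simps)
  next
    case False
    then have "0 \<le> \<eta> p" using \<eta> unfolding rerouting_def by blast
    then show ?thesis using e \<rho>[of p] by (simp add: \<rho>2_def \<rho>1_def)
  qed
  have "transport_plan q x0 y0 \<rho>2"
    unfolding transport_plan_def
  proof (intro conjI allI impI \<rho>2)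
    fix x assume "x \<noteq> x0"
    then have "((\<lambda>y. \<rho> (x, y) + e * \<eta> (x, y)) has_sum (q x0 x + e * 0)) UNIV"
      using plan \<eta> by (intro has_sum_add has_sum_cmult_right) (auto simp: transport_plan_def rerouting_def)
    then show "((\<lambda>y. \<rho>2 (x, y)) has_sum q x0 x) UNIV"
      using \<open>x \<noteq> x0\<close> by (simp add: \<rho>2_def \<rho>1_def)
  next
    fix y assume "y \<noteq> y0"
    then have "((\<lambda>x. \<rho> (x, y) + e * \<eta> (x, y)) has_sum (q y0 y + e * 0)) UNIV"
      using plan \<eta> by (intro has_sum_add has_sum_cmult_right) (auto simp: transport_plan_def rerouting_def)
    then show "((\<lambda>x. \<rho>2 (x, y)) has_sum q y0 y) UNIV"
      using \<open>y \<noteq> y0\<close> by (simp add: \<rho>2_def \<rho>1_def)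
  qed
  then have le: "tcost q x0 y0 \<rho>2 \<le> tcost q x0 y0 \<rho>" using opt by (simp add: optimal_plan_def)
  have sum_\<rho>: "((\<lambda>p. \<rho> p * ?w p) has_sum tcost q x0 y0 \<rho>) UNIV"
    using has_sum_support[OF \<rho> fin, of ?w UNIV] by (simp add: tcost_def infsumI)
  \<comment> \<open>Since \<open>\<eta>\<close> has total mass 0, the constant distance
    \<open>d x0 y0\<close> drops out.\<close>
  have "((\<lambda>p. \<eta> p * d x0 y0 - \<eta> p * d (fst p) (snd p)) has_sum (0 * d x0 y0 - c)) UNIV"
    using \<eta> by (intro has_sum_diff has_sum_cmult_left) (auto simp: rerouting_def)
  then have "((\<lambda>p. \<rho> p * ?w p + e * (\<eta> p * d x0 y0 - \<eta> p * d (fst p) (snd p)))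
      has_sum (tcost q x0 y0 \<rho> + e * (0 * d x0 y0 - c))) UNIV"
    by (intro has_sum_add has_sum_cmult_right sum_\<rho>)
  also have "(\<lambda>p. \<rho> p * ?w p + e * (\<eta> p * d x0 y0 - \<eta> p * d (fst p) (snd p))) = (\<lambda>p. \<rho>2 p * ?w p)"
    by (auto simp: \<rho>2_def \<rho>1_def fun_eq_iff algebra_simps)
  finally have "tcost q x0 y0 \<rho>2 = tcost q x0 y0 \<rho> - e * c"
    unfolding tcost_def[of _ _ _ \<rho>2] by (simp add: infsumI)
  with le e show ?thesis by (simp add: zero_le_mult_iff)
qed

text \<open>The potential at \<open>z\<close> is the cheapest way to reach \<open>z\<close> from \<open>x0\<close> by a rerouting followed by a
  direct move; optimality of the plan excludes negative cycles, so the infimum is finite.\<close>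
lemma optimal_plan_potential:
  assumes opt: "optimal_plan q x0 y0 \<rho>" and fin: "finite {p. 0 < \<rho> p}"
  obtains f :: "'v \<Rightarrow> real" where "\<And>x y. f y \<le> f x + d x y"
    and "f y0 = f x0 + d x0 y0" and "\<And>x y. 0 < \<rho> (x, y) \<Longrightarrow> f y = f x + d x y"
proof -
  define A where "A = insert (x0, y0) {p. 0 < \<rho> p}"
  define E where "E z = {c + d x z | x c. \<exists>\<eta>. rerouting A x0 x \<eta> c}" for z
  define f where "f z = Inf (E z)" for z
  have ne: "E z \<noteq> {}" for z unfolding E_def using rerouting_start by blast
  have bound: "d x0 y0 - d z y0 \<le> e" if "e \<in> E z" for e z
  proof -
    obtain x c \<eta> where e: "e = c + d x z" and \<eta>: "rerouting A x0 x \<eta> c"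
      using \<open>e \<in> E z\<close> unfolding E_def by blast
    \<comment> \<open>A further step through \<open>(x0, y0)\<close> closes the rerouting, which
      bounds \<open>c\<close> from below.\<close>
    have "(x0, y0) \<in> A" by (simp add: A_def)
    from rerouting_step[OF \<eta> this] have "0 \<le> c + d x y0 - d x0 y0"
      unfolding A_def by (rule closed_rerouting_cost_nonneg[OF opt fin])
    then show ?thesis using d_triangle[of x y0 z] by (simp add: e)
  qed
  then have bdd: "bdd_below (E z)" for z by (rule bdd_belowI)
  have lip: "f y \<le> f x + d x y" for x y
  proof -
    have "f y - d x y \<le> e" if "e \<in> E x" for e
    proof -
      obtain u c \<eta> where e: "e = c + d u x" and \<eta>: "rerouting A x0 u \<eta> c"
        using \<open>e \<in> E x\<close> unfolding E_def by blast
      have "f y \<le> c + d u y" unfolding f_def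
        by (rule cInf_lower[OF _ bdd]) (use \<eta> E_def in blast)
      then show ?thesis using d_triangle[of u y x] by (simp add: e)
    qed
    then have "f y - d x y \<le> f x" unfolding f_def[of x] by (intro cInf_greatest ne)
    then show ?thesis by simp
  qed
  have "f x \<le> f y - d x y" if mem: "(x, y) \<in> A" for x y
  proof -
    have "f x + d x y \<le> e" if "e \<in> E y" for e
    proof -
      obtain u c \<eta> where e: "e = c + d u y" and \<eta>: "rerouting A x0 u \<eta> c"
        using \<open>e \<in> E y\<close> unfolding E_def by blast
      \<comment> \<open>The step through \<open>(x, y)\<close> leaves the deficit at
        \<open>x\<close>; the direct move to \<open>x\<close> then has length 0.\<close>
      have "c + d u y - d x y + d x x \<in> E x"
        using rerouting_step[OF \<eta> mem] unfolding E_def by blast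
      then have "f x \<le> c + d u y - d x y + d x x" unfolding f_def by (rule cInf_lower[OF _ bdd])
      then show ?thesis by (simp add: e)
    qed
    then have "f x + d x y \<le> f y" unfolding f_def[of y] by (intro cInf_greatest ne)
    then show ?thesis by simp
  qed
  then have tight: "f y = f x + d x y" if "(x, y) \<in> A" for x y
    using lip[of y x] that by fastforce
  show thesis by (rule that[of f]) (use lip tight in \<open>auto simp: A_def\<close>)
qed

lemma tcost_eq_sum:
  assumes "\<And>p. 0 \<le> \<rho> p" "finite {p. 0 < \<rho> p}"
  shows "tcost q x0 y0 \<rho> = (\<Sum>p\<in>{p. 0 < \<rho> p}. \<rho> p * (d x0 y0 - d (fst p) (snd p)))"
  unfolding tcost_def using has_sum_support[OF assms, of _ UNIV] by (simp add: infsumI)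

lemma tmu_eq_sum:
  assumes "\<And>p. 0 \<le> \<rho> p" "finite {p. 0 < \<rho> p}"
  shows "tmu q x0 y0 \<rho> k
    = (\<Sum>p\<in>{p. 0 < \<rho> p}. \<rho> p * of_bool (int (gdist q (fst p) (snd p)) - int (gdist q x0 y0) = k))"
proof -
  have "tmu q x0 y0 \<rho> k = (\<Sum>p\<in>{p. 0 < \<rho> p} \<inter> {p. int (gdist q (fst p) (snd p)) - int (gdist q x0 y0) = k}. \<rho> p)"
    unfolding tmu_def
    using has_sum_support[OF assms, of "\<lambda>_. 1" "{p. int (gdist q (fst p) (snd p)) - int (gdist q x0 y0) = k}"]
    by (simp add: infsumI)
  also have "\<dots> = (\<Sum>p\<in>{p. 0 < \<rho> p}. if int (gdist q (fst p) (snd p)) - int (gdist q x0 y0) = k then \<rho> p else 0)"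
    using sum.inter_restrict[OF assms(2), of \<rho> "{p. int (gdist q (fst p) (snd p)) - int (gdist q x0 y0) = k}"]
    by simp
  finally show ?thesis by (simp add: of_bool_def if_distrib cong: if_cong)
qed

lemma coupling_lap:
  assumes "coupling_graph q qt"
  shows "lap qt (\<lambda>p. f (fst p)) (x, y) = lap q f x" "lap qt (\<lambda>p. f (snd p)) (x, y) = lap q f y"
  using assms by (auto simp: coupling_graph_def case_prod_unfold fun_eq_iff)

text \<open>Kantorovich duality by complementary slackness: the Laplacian difference of a potential that is
  tight on the support of the optimal plan equals the cost of that plan.\<close>
lemma optimal_coupling_cost_nonneg:
  assumes curv: "nonneg_curvature q" and coup: "coupling_graph q qt"
    and opt: "optimal_plan q x0 y0 (qt (x0, y0))" and ne: "x0 \<noteq> y0"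
  shows "0 \<le> tcost q x0 y0 (qt (x0, y0))"
proof -
  let ?P = "{p. 0 < qt (x0, y0) p}"
  have qt: "\<And>p. 0 \<le> qt (x0, y0) p" and fin: "finite ?P"
    using coup by (auto simp: coupling_graph_def is_graph_def)
  obtain f where lip: "\<And>x y. f y \<le> f x + d x y" and tight0: "f y0 = f x0 + d x0 y0"
    and tight: "\<And>x y. 0 < qt (x0, y0) (x, y) \<Longrightarrow> f y = f x + d x y"
    using optimal_plan_potential[OF opt fin] by blast
  \<comment> \<open>The coupling turns both Laplacians into sums over the support of one plan.
    Tightness then makes each summand its mass times the decrease in distance.\<close>
  have "lap q f x0 - lap q f y0
      = (\<Sum>p\<in>?P. qt (x0, y0) p * (f (fst p) - f x0) - qt (x0, y0) p * (f (snd p) - f y0))"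
    using coupling_lap[OF coup, of f x0 y0] by (simp add: lap_def sum_subtractf)
  also have "\<dots> = tcost q x0 y0 (qt (x0, y0))"
    unfolding tcost_eq_sum[OF qt fin]
    by (intro sum.cong refl) (auto simp: tight tight0 algebra_simps)
  finally show ?thesis using lap_le_of_tight_potential[OF curv ne lip tight0] by simp
qed

text \<open>Moving both points together costs 0, and no plan from \<open>(x, x)\<close> has positive
  cost. An optimal one thus has zero mean distance.\<close>

lemma optimal_plan_diagonal:
  assumes opt: "optimal_plan q x x \<rho>" and fin: "finite {p. 0 < \<rho> p}" and pos: "0 < \<rho> (a, b)"
  shows "a = b"
proof -
  define \<rho>' where "\<rho>' p = of_bool (fst p = snd p) * q x (fst p)" for p :: "'v \<times> 'v"
  have "transport_plan q x x \<rho>'"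
    unfolding transport_plan_def
  proof (intro conjI allI impI)
    show "0 \<le> \<rho>' p" for p by (simp add: \<rho>'_def q_nonneg)
    show "((\<lambda>b. \<rho>' (a, b)) has_sum q x a) UNIV" for a
      using has_sum_point[of a "\<lambda>_. q x a"] by (simp add: \<rho>'_def eq_commute[of a])
    show "((\<lambda>a. \<rho>' (a, b)) has_sum q x b) UNIV" for b
      using has_sum_point[of b "q x"] by (simp add: \<rho>'_def)
  qed
  then have "tcost q x x \<rho>' \<le> tcost q x x \<rho>" using opt by (simp add: optimal_plan_def)
  moreover have "tcost q x x \<rho>' = 0"
    unfolding tcost_def by (rule infsum_0) (auto simp: \<rho>'_def)
  moreover have \<rho>: "\<And>p. 0 \<le> \<rho> p"
    using opt unfolding optimal_plan_def transport_plan_def by blast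
  ultimately have "(\<Sum>p\<in>{p. 0 < \<rho> p}. \<rho> p * d (fst p) (snd p)) \<le> 0"
    by (simp add: tcost_eq_sum[OF _ fin] sum_negf)
  then have "\<forall>p\<in>{p. 0 < \<rho> p}. \<rho> p * d (fst p) (snd p) = 0"
    using sum_nonneg_eq_0_iff[OF fin, of "\<lambda>p. \<rho> p * d (fst p) (snd p)"] \<rho>
    by (meson antisym mult_nonneg_nonneg of_nat_0_le_iff sum_nonneg)
  with pos show ?thesis by fastforce
qed

text \<open>Jumps change the distance by at most 1, so only the rates \<open>up\<close> and
  \<open>down\<close> enter. Nonnegative cost gives \<open>up \<le> down\<close>, and monotonicity
  of \<open>g\<close> allows replacing \<open>up\<close> by \<open>down\<close>; this leaves
  \<open>down\<close> times a second difference.\<close>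

lemma lap_perfect_coupling_le:
  assumes curv: "nonneg_curvature q" and perf: "perfect_coupling q qt"
    and c: "0 \<le> c" "c = max (qmin q) 0"
    and mono: "\<And>n. g n \<le> g (Suc n)" and concave: "\<And>n. g (Suc (Suc n)) + g n \<le> 2 * g (Suc n)"
  shows "lap qt (\<lambda>p. g (gdist q (fst p) (snd p))) (x, y) \<le> lap (q0 c) g (gdist q x y)"
proof -
  let ?\<rho> = "qt (x, y)"
  let ?P = "{p. 0 < ?\<rho> p}"
  let ?d = "\<lambda>p. gdist q (fst p) (snd p)"
  let ?n = "gdist q x y"
  have coup: "coupling_graph q qt" and opt: "optimal_plan q x y ?\<rho>"
    and far: "\<And>k. \<bar>k\<bar> > 1 \<Longrightarrow> tmu q x y ?\<rho> k = 0"
    using perf by (auto simp: perfect_coupling_def)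
  have qt: "\<And>p. 0 \<le> ?\<rho> p" and fin: "finite ?P"
    using coup by (auto simp: coupling_graph_def is_graph_def)
  show ?thesis
  proof (cases "x = y")
    case True
    have "lap qt (\<lambda>p. g (?d p)) (x, y) = 0"
      unfolding lap_def
    proof (intro sum.neutral ballI)
      fix p assume "p \<in> ?P"
      then have "fst p = snd p" using optimal_plan_diagonal[of x ?\<rho> "fst p" "snd p"] opt fin True by simp
      then show "?\<rho> p * (g (?d p) - g (?d (x, y))) = 0" using True by simp
    qed
    then show ?thesis using True by (simp add: lap_q0)
  next
    case False
    then obtain n where n: "?n = Suc n" by (metis gdist_eq_0_iff not0_implies_Suc)
    define up where "up = tmu q x y ?\<rho> 1"
    define down where "down = tmu q x y ?\<rho> (-1)"
    have near: "?d p \<in> {n, Suc n, Suc (Suc n)}" if p: "p \<in> ?P" for p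
    proof (rule ccontr)
      let ?k = "int (?d p) - int ?n"
      assume "\<not> ?thesis"
      then have "\<bar>?k\<bar> > 1" using n by auto
      \<comment> \<open>The single mass at \<open>p\<close> is at most the total \<open>tmu\<close>
        of its displacement, which vanishes for displacements beyond 1.\<close>
      then have "(\<Sum>p'\<in>?P. ?\<rho> p' * of_bool (int (?d p') - int ?n = ?k)) = 0"
        using far[of ?k] by (simp add: tmu_eq_sum[OF qt fin])
      moreover have "?\<rho> p * of_bool (int (?d p) - int ?n = ?k)
          \<le> (\<Sum>p'\<in>?P. ?\<rho> p' * of_bool (int (?d p') - int ?n = ?k))"
        by (rule member_le_sum[OF p _ fin]) (simp add: qt)
      ultimately show False using p by simp
    qed
    have near_cases: "?d p = n \<or> ?d p = Suc n \<or> ?d p = Suc (Suc n)" if "p \<in> ?P" for p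
      using near[OF that] by blast
    have "lap qt (\<lambda>p. g (?d p)) (x, y)
        = (\<Sum>p\<in>?P. ?\<rho> p * of_bool (int (?d p) - int ?n = 1) * (g (Suc (Suc n)) - g (Suc n))
            + ?\<rho> p * of_bool (int (?d p) - int ?n = -1) * (g n - g (Suc n)))"
      unfolding lap_def by (intro sum.cong refl) (drule near_cases, elim disjE; simp add: n)
    also have "\<dots> = up * (g (Suc (Suc n)) - g (Suc n)) + down * (g n - g (Suc n))"
      by (simp add: up_def down_def tmu_eq_sum[OF qt fin] sum.distrib sum_distrib_right)
    also have "\<dots> \<le> down * (g (Suc (Suc n)) - g (Suc n)) + down * (g n - g (Suc n))"
    proof (intro add_right_mono mult_right_mono)
      have "tcost q x y ?\<rho> = (\<Sum>p\<in>?P. ?\<rho> p * of_bool (int (?d p) - int ?n = -1)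
          - ?\<rho> p * of_bool (int (?d p) - int ?n = 1))"
        unfolding tcost_eq_sum[OF qt fin]
        by (intro sum.cong refl) (drule near_cases, elim disjE; simp add: n algebra_simps)
      also have "\<dots> = down - up"
        by (simp add: up_def down_def tmu_eq_sum[OF qt fin] sum_subtractf)
      finally show "up \<le> down" using optimal_coupling_cost_nonneg[OF curv coup opt False] by simp
    qed (use mono in simp)
    also have "\<dots> = down * (g (Suc (Suc n)) + g n - 2 * g (Suc n))" by (simp add: algebra_simps)
    \<comment> \<open>By concavity the second difference is nonpositive, so a lower bound on
      \<open>down\<close> gives an upper bound here.\<close>
    also have "\<dots> \<le> (2 * c) * (g (Suc (Suc n)) + g n - 2 * g (Suc n))"
    proof (rule mult_right_mono_neg)
      have "0 \<le> down" by (simp add: down_def tmu_eq_sum[OF qt fin] qt sum_nonneg)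
      moreover have "2 * qmin q \<le> down" using perf False by (simp add: perfect_coupling_def down_def)
      ultimately show "2 * c \<le> down" using c by simp
    qed (use concave[of n] in simp)
    also have "\<dots> = lap (q0 c) g ?n" using c by (auto simp: n lap_q0)
    finally show ?thesis .
  qed
qed

end

section \<open>Comparison of the coupled semigroup with the walk\<close>

theorem mainTheorem8:
  fixes q :: "'a::countable \<Rightarrow> 'a \<Rightarrow> real"
    and qt :: "'a \<times> 'a \<Rightarrow> 'a \<times> 'a \<Rightarrow> real"
    and t :: real and x y :: 'a
  assumes "is_graph q" and "reversible q" and "graph_connected q"
    and "nonneg_curvature q"
    and "perfect_coupling q qt"
    and "t > 0"
  shows "heat qt t (indicator {p. fst p \<noteq> snd p}) (x, y) \<le> phi (qmin q) t (gdist q x y)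
    \<and> (qmin q > 0 \<longrightarrow>
         phi (qmin q) t (gdist q x y) \<le> real (gdist q x y) / (2 * sqrt (t * qmin q)))"
proof -
  interpret reversible_connected_graph q by unfold_locales fact+
  \<comment> \<open>If \<open>q\<close> has no positive rate, \<open>qmin q\<close> is the
    unspecified infimum of the empty set; truncation at 0 covers this case.\<close>
  define c where "c = max (qmin q) 0"
  have c: "0 \<le> c" by (simp add: c_def)
  have phi: "phi (qmin q) t n = survival (4 * c * t) n" for n
    using \<open>t > 0\<close> by (simp add: phi_eq_survival c_def)
  have graph_qt: "is_graph qt"
    using \<open>perfect_coupling q qt\<close> by (simp add: perfect_coupling_def coupling_graph_def)
  have "heatS qt S t (indicator {p. fst p \<noteq> snd p}) (x, y) \<le> survival (4 * c * t) (gdist q (fst (x, y)) (snd (x, y)))"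
    if S: "finite S" for S
  proof (rule heatS_le_supersolution[OF graph_qt S])
    show "((\<lambda>s. survival (4 * c * s) (gdist q (fst p) (snd p))) has_real_derivative
        lap (q0 c) (survival (4 * c * s)) (gdist q (fst p) (snd p))) (at s)" for s p
      by (rule survival_heat_equation[OF c])
    show "lap qt (\<lambda>p. survival (4 * c * s) (gdist q (fst p) (snd p))) p
        \<le> lap (q0 c) (survival (4 * c * s)) (gdist q (fst p) (snd p))" if "0 \<le> s" for s p
      using lap_perfect_coupling_le[OF \<open>nonneg_curvature q\<close> \<open>perfect_coupling q qt\<close> c c_def,
          of "survival (4 * c * s)" "fst p" "snd p"] c that
      by (simp add: survival_mono survival_concave)
  qed (use c \<open>t > 0\<close> in \<open>auto simp: survival_nonneg survival_init indicator_def gdist_pos\<close>)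
  then have "heat qt t (indicator {p. fst p \<noteq> snd p}) (x, y) \<le> phi (qmin q) t (gdist q x y)"
    using \<open>t > 0\<close> by (intro heat_le graph_qt) (auto simp: phi)
  moreover have "phi (qmin q) t (gdist q x y) \<le> real (gdist q x y) / (2 * sqrt (t * qmin q))"
    if "qmin q > 0"
  proof -
    have "sqrt (4 * c * t) = 2 * sqrt (t * qmin q)"
      using that by (simp add: c_def real_sqrt_mult)
    then show ?thesis
      using survival_le[of "4 * c * t" "gdist q x y"] that \<open>t > 0\<close> by (simp add: phi c_def)
  qed
  ultimately show ?thesis by blast
qed

end
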